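(* Let $n,m$ be two positive integers. Then $$\frac{(-1)^{n}}{n!}B_{n}^{(m)}=\det M,$$ where $M$ is the $n\times n$ matrix whose $(i,j)$ entry is $\frac{1}{(j-i+1)!}B_{j-i+1}^{(-m)}$ if $j\ge i$, $1$ if $i=j+1$, and $0$ if $i>j+1$. Moreover, $$\frac{1}{n!}B_{n}^{(m)}=\sum_{\substack{k_1+k_2+\cdots+k_n=l \\ k_1+2k_2+\cdots+nk_n=n}}(-1)^{l}\frac{l!}{k_1!k_2!\cdots k_n!}\left(\frac{1}{1!}B_{1}^{(-m)}\right)^{k_1}\left(\frac{1}{2!}B_{2}^{(-m)}\right)^{k_2}\cdots \left(\frac{1}{n!}B_{n}^{(-m)}\right)^{k_n}.$$
   Context: For any integer $m$, the generalized Bernoulli numbers $B_n^{(m)}$ are defined by the formal power series identity $\left(1+\sum_{n\geq 1}\frac{1}{(n+1)!}X^{n}\right)^{-m}=1+\sum_{n\geq 1}\frac{1}{n!}B_{n}^{(m)}X^{n}$. The sum runs over all tuples of nonnegative integers $(k_1,\ldots,k_n)$ with $k_1+2k_2+\cdots+nk_n=n$, where $l=k_1+\cdots+k_n$. *)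

theory Defs
  imports
    "HOL-Computational_Algebra.Formal_Power_Series"
    "HOL-Library.FuncSet"
    "Jordan_Normal_Form.Determinant"
begin

(* The series 1 + \<Sum>n\<ge>1. X^n / (n+1)!, that is, (exp X - 1) / X. *)
definition bernoulli_base :: "rat fps" where
  "bernoulli_base = Abs_fps (\<lambda>n. 1 / fact (n + 1))"

(* The constant coefficient of bernoulli_base is 1, so negative exponents of powi
   are genuine powers of the multiplicative inverse. *)
definition gen_bernoulli :: "int \<Rightarrow> nat \<Rightarrow> rat" where
  "gen_bernoulli m n = fact n * fps_nth (bernoulli_base powi (- m)) n"

lemma gen_bernoulli_gf:
  "bernoulli_base powi (- m) = Abs_fps (\<lambda>n. 1 / fact n * gen_bernoulli m n)"
  by (simp add: fps_eq_iff gen_bernoulli_def)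

lemma bernoulli_base_inverse: "bernoulli_base * inverse bernoulli_base = 1"
  by (rule inverse_mult_eq_1') (simp add: bernoulli_base_def)

lemma gen_bernoulli_0: "gen_bernoulli m 0 = 1"
  by (simp add: gen_bernoulli_def power_int_def bernoulli_base_def fps_power_zeroth)

(* Rows and columns are indexed from 0; the entries depend only on j - i,
   so the shift from 1-based indices does not affect the formula. *)
definition bernoulli_mat :: "nat \<Rightarrow> nat \<Rightarrow> rat mat" where
  "bernoulli_mat m n = mat n n (\<lambda>(i, j).
     if j \<ge> i then 1 / fact (j - i + 1) * gen_bernoulli (- int m) (j - i + 1)
     else if i = j + 1 then 1
     else 0)"

(* Tuples (k_1, ..., k_n), encoded as extensional functions on {1..n} so that
   each tuple is counted once. *)
definition weighted_tuples :: "nat \<Rightarrow> (nat \<Rightarrow> nat) set" where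
  "weighted_tuples n = {k \<in> {1..n} \<rightarrow>\<^sub>E UNIV. (\<Sum>i=1..n. i * k i) = n}"

lemma finite_weighted_tuples: "finite (weighted_tuples n)"
proof (rule finite_subset)
  show "weighted_tuples n \<subseteq> {1..n} \<rightarrow>\<^sub>E {0..n}"
  proof
    fix k assume k: "k \<in> weighted_tuples n"
    have "k i \<le> n" if i: "i \<in> {1..n}" for i
    proof -
      have "k i \<le> i * k i" using i by simp
      also have "\<dots> \<le> (\<Sum>i=1..n. i * k i)"
        using i by (intro member_le_sum) auto
      finally show ?thesis using k by (simp add: weighted_tuples_def)
    qed
    then show "k \<in> {1..n} \<rightarrow>\<^sub>E {0..n}"
      using k by (auto simp: weighted_tuples_def PiE_iff)
  qed
  show "finite ({1..n} \<rightarrow>\<^sub>E {0..n})" by (intro finite_PiE) auto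
qed

end

theory Submission
  imports Defs
begin

text \<open>
  Both identities are statements about a power series \<open>F\<close> with constant term \<open>1\<close> and its
  reciprocal; the Bernoulli numbers enter only through \<open>F = ((exp X - 1) / X) ^ m\<close>, because the
  numbers of order \<open>-m\<close> are the normalised coefficients of \<open>F\<close> and those of order \<open>m\<close> are the
  normalised coefficients of \<open>1 / F\<close>.

  For the determinant, upper triangular Toeplitz matrices multiply as power series do, so the matrix
  of \<open>1 / F\<close> is the inverse of the matrix of \<open>F\<close>. The latter has determinant \<open>1\<close>, hence its inverse
  is its adjugate. In size \<open>n + 1\<close> the top right entry of the inverse is the \<open>n\<close>-th coefficient of
  \<open>1 / F\<close>, while in the adjugate it is \<open>(- 1) ^ n\<close> times the minor obtained by deleting the last row
  and the first column. That deletion moves the unit diagonal of the Toeplitz matrix to the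
  subdiagonal, which turns the minor into the Hessenberg determinant of the theorem
  (\<open>fps_reciprocal_nth_eq_det\<close>).

  For the sum, expand \<open>1 / F = 1 / (1 + (F - 1))\<close> as a geometric series. Since \<open>F - 1\<close> has no constant
  term, only the powers up to the \<open>n\<close>-th contribute to the coefficient of \<open>X ^ n\<close>, and within them
  only the terms of \<open>F - 1\<close> of degrees \<open>1\<close> to \<open>n\<close>. These are finite sums, to which the multinomial
  theorem applies: the monomial belonging to \<open>k\<close> has degree \<open>\<Sum>i. i * k i\<close>, so the coefficient of
  \<open>X ^ n\<close> picks out the weighted tuples (\<open>fps_inverse_nth_eq_multinomial_sum\<close>).
\<close>

section \<open>Toeplitz matrices of power series\<close>

definition toeplitz :: "nat \<Rightarrow> 'a::zero fps \<Rightarrow> 'a mat" where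
  "toeplitz N F = mat N N (\<lambda>(i, j). if i \<le> j then fps_nth F (j - i) else 0)"

lemma toeplitz_carrier [simp]: "toeplitz N F \<in> carrier_mat N N"
  by (simp add: toeplitz_def)

lemma toeplitz_index [simp]:
  "i < N \<Longrightarrow> j < N \<Longrightarrow> toeplitz N F $$ (i, j) = (if i \<le> j then fps_nth F (j - i) else 0)"
  by (simp add: toeplitz_def)

lemma toeplitz_dim [simp]: "dim_row (toeplitz N F) = N" "dim_col (toeplitz N F) = N"
  by (simp_all add: toeplitz_def)

lemma toeplitz_one: "toeplitz N 1 = (1\<^sub>m N :: 'a::comm_ring_1 mat)"
  by (rule eq_matI) auto

text \<open>
  In the matrix product only the inner indices \<open>k\<close> between \<open>i\<close> and \<open>j\<close> survive, and the shift
  \<open>t = k - i\<close> turns what remains into the Cauchy product.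
\<close>

lemma toeplitz_mult:
  fixes F G :: "'a::comm_ring_1 fps"
  shows "toeplitz N (F * G) = toeplitz N F * toeplitz N G"
proof (rule eq_matI)
  fix i j assume "i < dim_row (toeplitz N F * toeplitz N G)"
    and "j < dim_col (toeplitz N F * toeplitz N G)"
  then have ij: "i < N" "j < N" by auto
  have "(toeplitz N F * toeplitz N G) $$ (i, j) =
      (\<Sum>k<N. (if i \<le> k then fps_nth F (k - i) else 0) * (if k \<le> j then fps_nth G (j - k) else 0))"
    using ij by (auto simp: scalar_prod_def atLeast0LessThan intro!: sum.cong)
  also have "\<dots> = (\<Sum>k\<in>{i..j}. fps_nth F (k - i) * fps_nth G (j - k))"
    using ij by (intro sum.mono_neutral_cong_right) auto
  also have "\<dots> = toeplitz N (F * G) $$ (i, j)"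
  proof (cases "i \<le> j")
    case True
    have "(\<Sum>k\<in>{i..j}. fps_nth F (k - i) * fps_nth G (j - k)) =
        (\<Sum>t = 0..j - i. fps_nth F t * fps_nth G (j - i - t))"
      using True
      by (intro sum.reindex_bij_witness[of _ "\<lambda>t. t + i" "\<lambda>k. k - i"]) auto
    with True ij show ?thesis by (simp add: fps_mult_nth)
  qed (use ij in auto)
  finally show "toeplitz N (F * G) $$ (i, j) = (toeplitz N F * toeplitz N G) $$ (i, j)" ..
qed auto

lemma det_toeplitz:
  fixes F :: "'a::comm_ring_1 fps"
  assumes "fps_nth F 0 = 1"
  shows "det (toeplitz N F) = 1"
proof -
  have "diag_mat (toeplitz N F) = map (\<lambda>_. 1) [0..<N]"
    using assms by (auto simp: diag_mat_def)
  moreover have "prod_list (map (\<lambda>_. 1) xs) = (1::'a)" for xs :: "nat list"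
    by (induction xs) auto
  ultimately show ?thesis
    by (subst det_upper_triangular[of _ N]) auto
qed

text \<open>
  Compare the entry \<open>(0, n)\<close> of the inverse of the Toeplitz matrix of \<open>F\<close> in its two descriptions,
  as the Toeplitz matrix of \<open>G\<close> and as an adjugate.
\<close>

lemma fps_reciprocal_nth_eq_det:
  fixes F G :: "'a::comm_ring_1 fps"
  assumes FG: "F * G = 1" and F0: "fps_nth F 0 = 1"
  shows "fps_nth G n = (- 1) ^ n *
    det (mat n n (\<lambda>(i, j). if j \<ge> i then fps_nth F (j - i + 1) else if i = j + 1 then 1 else 0))"
    (is "_ = _ * det ?M")
proof -
  let ?A = "toeplitz (Suc n) F" and ?B = "toeplitz (Suc n) G"
  have A: "?A \<in> carrier_mat (Suc n) (Suc n)" and B: "?B \<in> carrier_mat (Suc n) (Suc n)" by simp_all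
  have BA: "?B * ?A = 1\<^sub>m (Suc n)"
    using FG by (simp add: toeplitz_one mult.commute flip: toeplitz_mult)
  have "adj_mat ?A = (?B * ?A) * adj_mat ?A"
    using adj_mat(1)[OF A] by (simp add: BA)
  also have "\<dots> = ?B * (?A * adj_mat ?A)"
    by (rule assoc_mult_mat[OF B A adj_mat(1)[OF A]])
  also have "\<dots> = ?B"
    by (subst adj_mat(2)[OF A], rule eq_matI) (simp_all add: det_toeplitz F0)
  finally have "?B $$ (0, n) = adj_mat ?A $$ (0, n)" by simp
  also have "\<dots> = (- 1) ^ n * det (mat_delete ?A n 0)"
    by (simp add: adj_mat_def cofactor_def)
  \<comment> \<open>Deleting column \<open>0\<close> turns the entry \<open>F $ (j - i)\<close> into \<open>F $ (j + 1 - i)\<close>; the former diagonal,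
     filled with \<open>F $ 0 = 1\<close>, becomes the subdiagonal.\<close>
  also have "mat_delete ?A n 0 = ?M"
    by (rule eq_matI) (auto simp: mat_delete_def F0 Suc_diff_le not_le le_Suc_eq)
  finally show ?thesis by simp
qed

section \<open>The multinomial theorem\<close>

text \<open>
  A natural number, so that the multinomial theorem can be stated over every commutative semiring;
  power series over a field do not themselves form a field. The division is exact by the next lemma.
\<close>

definition multinomial :: "'i set \<Rightarrow> ('i \<Rightarrow> nat) \<Rightarrow> nat" where
  "multinomial I k = fact (sum k I) div (\<Prod>i\<in>I. fact (k i))"

lemma prod_fact_dvd_fact_sum:
  fixes k :: "'i \<Rightarrow> nat"
  assumes "finite I"
  shows "(\<Prod>i\<in>I. fact (k i)) dvd (fact (sum k I) :: nat)"
  using assms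
proof (induction I)
  case (insert j I)
  then have "(\<Prod>i\<in>insert j I. fact (k i)) dvd (fact (k j) * fact (sum k I) :: nat)"
    by (simp add: mult_dvd_mono)
  also have "\<dots> dvd fact (k j + sum k I)" by (rule fact_fact_dvd_fact)
  finally show ?case using insert by simp
qed simp

lemma multinomial_times_prod_fact:
  assumes "finite I"
  shows "multinomial I k * (\<Prod>i\<in>I. fact (k i)) = fact (sum k I)"
  using prod_fact_dvd_fact_sum[OF assms, of k] by (simp add: multinomial_def)

lemma of_nat_multinomial:
  assumes "finite I"
  shows "(of_nat (multinomial I k) :: 'a::field_char_0) = fact (sum k I) / (\<Prod>i\<in>I. fact (k i))"
proof -
  have "(of_nat (multinomial I k) :: 'a) * (\<Prod>i\<in>I. fact (k i)) = fact (sum k I)"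
    using arg_cong[OF multinomial_times_prod_fact[OF assms, of k], of "of_nat :: nat \<Rightarrow> 'a"]
    by simp
  then show ?thesis by (simp add: field_simps assms)
qed

lemma multinomial_cong: "(\<And>i. i \<in> I \<Longrightarrow> k i = k' i) \<Longrightarrow> multinomial I k = multinomial I k'"
  by (simp add: multinomial_def)

text \<open>
  Arranging objects of all colours amounts to choosing the places of colour \<open>j\<close> and arranging the
  remaining colours. This recursion drives the induction in the multinomial theorem.
\<close>

lemma multinomial_insert:
  assumes "finite I" "j \<notin> I"
  shows "multinomial (insert j I) k = ((k j + sum k I) choose k j) * multinomial I k"
proof -
  let ?P = "\<Prod>i\<in>I. fact (k i) :: nat"
  have "multinomial (insert j I) k * (fact (k j) * ?P) = fact (k j + sum k I)"
    using multinomial_times_prod_fact[of "insert j I" k] assms by simp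
  also have "\<dots> = fact (k j) * fact (sum k I) * ((k j + sum k I) choose k j)"
    using binomial_fact_lemma[of "k j" "k j + sum k I"] by simp
  also have "\<dots> = ((k j + sum k I) choose k j) * multinomial I k * (fact (k j) * ?P)"
    by (simp flip: multinomial_times_prod_fact[OF assms(1), of k])
  finally show ?thesis using assms by simp
qed

lemma finite_tuples_with_sum:
  fixes l :: nat
  assumes "finite I"
  shows "finite {k \<in> I \<rightarrow>\<^sub>E UNIV. sum k I = l}"
proof (rule finite_subset)
  show "{k \<in> I \<rightarrow>\<^sub>E UNIV. sum k I = l} \<subseteq> I \<rightarrow>\<^sub>E {..l}"
    using assms by (auto simp: PiE_iff extensional_def intro: member_le_sum)
  show "finite (I \<rightarrow>\<^sub>E {..l})" using assms by (intro finite_PiE) auto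
qed

text \<open>
  By induction on \<open>I\<close>: the binomial theorem splits off the power \<open>t\<close> of the new summand, and a tuple
  on \<open>insert j I\<close> with total \<open>l\<close> is the same as a value \<open>t \<le> l\<close> at \<open>j\<close> together with a tuple on \<open>I\<close>
  with total \<open>l - t\<close>.
\<close>

theorem multinomial_ring:
  fixes x :: "'i \<Rightarrow> 'a::comm_semiring_1"
  assumes "finite I"
  shows "(\<Sum>i\<in>I. x i) ^ l =
    (\<Sum>k | k \<in> I \<rightarrow>\<^sub>E UNIV \<and> sum k I = l. of_nat (multinomial I k) * (\<Prod>i\<in>I. x i ^ k i))"
  using assms
proof (induction I arbitrary: l)
  case empty
  have "{k. k \<in> {} \<rightarrow>\<^sub>E UNIV \<and> sum k {} = l} = (if l = 0 then {\<lambda>_. undefined} else {})"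
    for l :: nat
    by auto
  then show ?case by (cases l) (simp_all add: multinomial_def)
next
  case (insert j I)
  let ?K = "\<lambda>I l. {k. k \<in> I \<rightarrow>\<^sub>E UNIV \<and> sum k I = l}"
  let ?g = "\<lambda>l t k. of_nat (l choose t) * x j ^ t * (of_nat (multinomial I k) * (\<Prod>i\<in>I. x i ^ k i))"
  have "(\<Sum>i\<in>insert j I. x i) ^ l = (\<Sum>t\<le>l. of_nat (l choose t) * x j ^ t * (\<Sum>i\<in>I. x i) ^ (l - t))"
    using insert.hyps by (simp add: binomial_ring)
  also have "\<dots> = (\<Sum>t\<le>l. \<Sum>k\<in>?K I (l - t). ?g l t k)"
    by (simp add: insert.IH sum_distrib_left)
  also have "\<dots> = (\<Sum>(t, k)\<in>Sigma {..l} (\<lambda>t. ?K I (l - t)). ?g l t k)"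
    using insert.hyps by (subst sum.Sigma) (auto intro: finite_tuples_with_sum)
  also have "\<dots> = (\<Sum>k\<in>?K (insert j I) l. of_nat (multinomial (insert j I) k) * (\<Prod>i\<in>insert j I. x i ^ k i))"
    \<comment> \<open>Tuples are extensional, so restricting \<open>k\<close> to \<open>I\<close> resets the value at \<open>j\<close> to \<open>undefined\<close>.\<close>
  proof (rule sum.reindex_bij_witness[of _ "\<lambda>k. (k j, k(j := undefined))" "\<lambda>(t, k). k(j := t)"])
    fix p assume "p \<in> Sigma {..l} (\<lambda>t. ?K I (l - t))"
    then obtain t k where p: "p = (t, k)" and t: "t \<le> l" and k: "k \<in> I \<rightarrow>\<^sub>E UNIV" "sum k I = l - t"
      by auto
    let ?k = "k(j := t)"
    have off: "i \<in> I \<Longrightarrow> ?k i = k i" for i using insert.hyps by auto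
    have sum_off: "sum ?k I = sum k I" by (rule sum.cong) (auto simp: off simp del: fun_upd_apply)
    show "(case p of (t, k) \<Rightarrow> k(j := t)) \<in> ?K (insert j I) l"
      using k t insert.hyps sum_off by (auto simp: p PiE_iff extensional_def)
    show "((case p of (t, k) \<Rightarrow> k(j := t)) j, (case p of (t, k) \<Rightarrow> k(j := t))(j := undefined)) = p"
      using k insert.hyps by (auto simp: p PiE_iff extensional_def)
    have "multinomial (insert j I) ?k = (l choose t) * multinomial I k"
      using insert.hyps sum_off k t multinomial_cong[of I ?k k] off
      by (subst multinomial_insert) auto
    moreover have "(\<Prod>i\<in>I. x i ^ ?k i) = (\<Prod>i\<in>I. x i ^ k i)"
      by (rule prod.cong) (auto simp: off simp del: fun_upd_apply)
    ultimately show "of_nat (multinomial (insert j I) (case p of (t, k) \<Rightarrow> k(j := t))) *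
        (\<Prod>i\<in>insert j I. x i ^ (case p of (t, k) \<Rightarrow> k(j := t)) i) = (case p of (t, k) \<Rightarrow> ?g l t k)"
      using insert.hyps by (simp add: p mult_ac del: fun_upd_apply) (simp add: mult_ac)
  next
    fix k assume k: "k \<in> ?K (insert j I) l"
    have "sum (k(j := undefined)) I = sum k I"
      using insert.hyps by (intro sum.cong) auto
    then show "(k j, k(j := undefined)) \<in> Sigma {..l} (\<lambda>t. ?K I (l - t))"
      using k insert.hyps by (auto simp: PiE_iff extensional_def)
  qed auto
  finally show ?case .
qed

section \<open>Coefficients of a reciprocal\<close>

lemma fps_power_nth_cong:
  fixes P Q :: "'a::comm_semiring_1 fps"
  assumes "\<And>i. i \<le> n \<Longrightarrow> fps_nth P i = fps_nth Q i"
  shows "fps_nth (P ^ l) n = fps_nth (Q ^ l) n"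
proof -
  have "i \<le> n \<Longrightarrow> fps_nth (P ^ l) i = fps_nth (Q ^ l) i" for i
    by (induction l arbitrary: i) (auto simp: fps_mult_nth assms intro!: sum.cong)
  then show ?thesis by simp
qed

text \<open>
  Substituting \<open>F - 1\<close> for \<open>X\<close> in the geometric series \<open>1 / (1 + X)\<close> is legitimate because \<open>F - 1\<close>
  has no constant term; for the same reason the powers beyond the \<open>n\<close>-th contribute nothing in degree \<open>n\<close>.
\<close>

lemma fps_inverse_nth_eq_alternating_sum:
  fixes F :: "'a::field fps"
  assumes "fps_nth F 0 = 1"
  shows "fps_nth (inverse F) n = (\<Sum>l = 0..n. (- 1) ^ l * fps_nth ((F - 1) ^ l) n)"
proof -
  have "inverse F = inverse ((1 + fps_X) oo (F - 1))"
    using assms by (simp add: fps_compose_add_distrib fps_X_fps_compose_startby0)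
  also have "\<dots> = inverse (1 + fps_X) oo (F - 1)"
    using assms by (subst fps_inverse_compose) auto
  finally show ?thesis
    by (simp add: fps_compose_nth fps_inverse_fps_X_plus1)
qed

text \<open>
  The multinomial theorem needs finitely many summands, so \<open>P\<close> is first replaced by its terms of
  degrees \<open>1\<close> to \<open>n\<close>; this does not affect the coefficient of degree \<open>n\<close> of its powers.
\<close>

lemma fps_power_nth_eq_multinomial_sum:
  fixes P :: "'a::field_char_0 fps"
  assumes "fps_nth P 0 = 0"
  shows "fps_nth (P ^ l) n =
    (\<Sum>k | k \<in> weighted_tuples n \<and> sum k {1..n} = l.
       fact l / (\<Prod>i=1..n. fact (k i)) * (\<Prod>i=1..n. fps_nth P i ^ k i))"
proof -
  let ?Q = "\<Sum>i=1..n. fps_const (fps_nth P i) * fps_X ^ i"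
  let ?K = "{k. k \<in> {1..n} \<rightarrow>\<^sub>E UNIV \<and> sum k {1..n} = l}"
  have "fps_nth ?Q i = fps_nth P i" if "i \<le> n" for i
  proof -
    have "fps_nth ?Q i = (\<Sum>j=1..n. if j = i then fps_nth P i else 0)"
      unfolding fps_sum_nth by (intro sum.cong) (auto simp: fps_X_power_nth)
    also have "\<dots> = fps_nth P i"
      using that assms by (cases "i = 0") auto
    finally show ?thesis .
  qed
  then have "fps_nth (P ^ l) n = fps_nth (?Q ^ l) n"
    by (intro fps_power_nth_cong) auto
  also have "?Q ^ l = (\<Sum>k\<in>?K. of_nat (multinomial {1..n} k) *
      (\<Prod>i=1..n. (fps_const (fps_nth P i) * fps_X ^ i) ^ k i))"
    by (rule multinomial_ring) simp
  also have "\<dots> = (\<Sum>k\<in>?K. fps_const (fact l / (\<Prod>i=1..n. fact (k i)) * (\<Prod>i=1..n. fps_nth P i ^ k i)) *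
      fps_X ^ (\<Sum>i=1..n. i * k i))"
  proof (rule sum.cong[OF refl])
    fix k assume k: "k \<in> ?K"
    have "of_nat (multinomial {1..n} k) = fps_const (fact l / (\<Prod>i=1..n. fact (k i)) :: 'a)"
      using k of_nat_multinomial[of "{1..n}" k, where 'a = 'a]
      by (simp flip: fps_of_nat)
    moreover have "(\<Prod>i\<in>I. (fps_const (fps_nth P i) * fps_X ^ i) ^ k i) =
        fps_const (\<Prod>i\<in>I. fps_nth P i ^ k i) * fps_X ^ (\<Sum>i\<in>I. i * k i)" if "finite I" for I
      using that by (induction I) (simp_all add: power_mult_distrib power_mult power_add mult_ac
          flip: fps_const_mult)
    ultimately show "of_nat (multinomial {1..n} k) *
        (\<Prod>i=1..n. (fps_const (fps_nth P i) * fps_X ^ i) ^ k i) =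
      fps_const (fact l / (\<Prod>i=1..n. fact (k i)) * (\<Prod>i=1..n. fps_nth P i ^ k i)) *
      fps_X ^ (\<Sum>i=1..n. i * k i)"
      by (simp flip: mult.assoc)
  qed
  also have "fps_nth \<dots> n = (\<Sum>k\<in>?K. if (\<Sum>i=1..n. i * k i) = n
      then fact l / (\<Prod>i=1..n. fact (k i)) * (\<Prod>i=1..n. fps_nth P i ^ k i) else 0)"
    by (auto simp: fps_sum_nth fps_X_power_nth intro!: sum.cong)
  also have "\<dots> = (\<Sum>k | k \<in> weighted_tuples n \<and> sum k {1..n} = l.
       fact l / (\<Prod>i=1..n. fact (k i)) * (\<Prod>i=1..n. fps_nth P i ^ k i))"
    using finite_tuples_with_sum[of "{1..n}" l]
    by (intro sum.mono_neutral_cong_right) (auto simp: weighted_tuples_def)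
  finally show ?thesis .
qed

text \<open>
  The alternating sum over the power \<open>l\<close> of \<open>F - 1\<close> groups the weighted tuples by their total \<open>l\<close>.
\<close>

lemma fps_inverse_nth_eq_multinomial_sum:
  fixes F :: "'a::field_char_0 fps"
  assumes "fps_nth F 0 = 1"
  shows "fps_nth (inverse F) n =
    (\<Sum>k\<in>weighted_tuples n. (- 1) ^ sum k {1..n} *
       (fact (sum k {1..n}) / (\<Prod>i=1..n. fact (k i))) * (\<Prod>i=1..n. fps_nth F i ^ k i))"
proof -
  let ?h = "\<lambda>k. (- 1) ^ sum k {1..n} *
       (fact (sum k {1..n}) / (\<Prod>i=1..n. fact (k i))) * (\<Prod>i=1..n. fps_nth F i ^ k i)"
  have "fps_nth (inverse F) n =
      (\<Sum>l = 0..n. \<Sum>k | k \<in> weighted_tuples n \<and> sum k {1..n} = l. ?h k)"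
    unfolding fps_inverse_nth_eq_alternating_sum[OF assms]
    using assms
    by (auto simp: fps_power_nth_eq_multinomial_sum sum_distrib_left mult.assoc intro!: sum.cong prod.cong)
  also have "\<dots> = sum ?h (weighted_tuples n)"
  proof (rule sum.group)
    \<comment> \<open>The weights are at least \<open>1\<close>, so a tuple of weight \<open>n\<close> has total at most \<open>n\<close> and none is lost.\<close>
    have "sum k {1..n} \<le> (\<Sum>i=1..n. i * k i)" for k :: "nat \<Rightarrow> nat"
      by (intro sum_mono) auto
    then show "(\<lambda>k. sum k {1..n}) ` weighted_tuples n \<subseteq> {0..n}"
      by (auto simp: weighted_tuples_def) (metis One_nat_def)
  qed (auto simp: finite_weighted_tuples)
  finally show ?thesis .
qed

section \<open>Generalized Bernoulli numbers\<close>

lemma bernoulli_base_power_nth_0: "fps_nth (bernoulli_base ^ m) 0 = 1"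
  by (simp add: bernoulli_base_def fps_power_zeroth)

lemma gen_bernoulli_neg: "1 / fact i * gen_bernoulli (- int m) i = fps_nth (bernoulli_base ^ m) i"
  by (simp add: gen_bernoulli_def power_int_def)

lemma gen_bernoulli_pos: "1 / fact n * gen_bernoulli (int m) n = fps_nth (inverse (bernoulli_base ^ m)) n"
  by (cases "m = 0") (simp_all add: gen_bernoulli_def power_int_def fps_inverse_power)

theorem theorem2p5:
  fixes n m :: nat
  assumes "n > 0" and "m > 0"
  shows "(- 1) ^ n / fact n * gen_bernoulli (int m) n = det (bernoulli_mat m n) \<and>
    1 / fact n * gen_bernoulli (int m) n =
      (\<Sum>k\<in>weighted_tuples n.
         let l = (\<Sum>i=1..n. k i) in
           (- 1) ^ l * (fact l / (\<Prod>i=1..n. fact (k i))) *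
           (\<Prod>i=1..n. (1 / fact i * gen_bernoulli (- int m) i) ^ k i))"
proof
  let ?F = "bernoulli_base ^ m"
  have "fps_nth (inverse ?F) n = (- 1) ^ n * det (bernoulli_mat m n)"
    unfolding bernoulli_mat_def gen_bernoulli_neg
    by (rule fps_reciprocal_nth_eq_det)
      (simp_all add: bernoulli_base_power_nth_0 inverse_mult_eq_1')
  moreover have "(- 1) ^ n / fact n * gen_bernoulli (int m) n = (- 1) ^ n * fps_nth (inverse ?F) n"
    by (simp flip: gen_bernoulli_pos)
  ultimately show "(- 1) ^ n / fact n * gen_bernoulli (int m) n = det (bernoulli_mat m n)"
    by (simp flip: mult.assoc power_mult_distrib)
  show "1 / fact n * gen_bernoulli (int m) n =
      (\<Sum>k\<in>weighted_tuples n.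
         let l = (\<Sum>i=1..n. k i) in
           (- 1) ^ l * (fact l / (\<Prod>i=1..n. fact (k i))) *
           (\<Prod>i=1..n. (1 / fact i * gen_bernoulli (- int m) i) ^ k i))"
    unfolding gen_bernoulli_neg gen_bernoulli_pos Let_def
    by (rule fps_inverse_nth_eq_multinomial_sum) (rule bernoulli_base_power_nth_0)
qed

end
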